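(* Let $\mathcal S$ be a finite set of $n\ge 1$ two-bar charts such that the first bar of each 2-BC in $\mathcal S$ is big, i.e. $a_i>\frac12$ for all $i\in\mathcal S$. Let $p^g$ be the packing of $\mathcal S$ constructed by algorithm GALO, and let $OPT$ be the length of an optimal packing, i.e. the minimal length of a feasible packing of $\mathcal S$. Then $L(p^g)\le OPT+1$.
   Context: A two-bar chart (2-BC) $i$ is an ordered pair of bars with heights $a_i$ (first, or left, bar) and $b_i$ (second, or right, bar), where $a_i,b_i\in(0,1]$. A bar is big if its height is greater than $\frac12$. For integers $k\le r$, $[k,r]=\{k,k+1,\ldots,r\}$. Given a finite set $\mathcal S$ of $n\ge 1$ 2-BCs and $2n$ unit-capacity bins numbered $1,\ldots,2n$, a packing is a function $p:\mathcal S\to[1,2n-1]$; the first bar of $i$ is put in bin $p(i)$ and its second bar in bin $p(i)+1$. Let $B_k=\{i\in\mathcal S\mid p(i)=k\}$ for $k\in[1,2n]$ and $B_0=\emptyset$. The packing is feasible if $\sum_{i\in B_k}a_i+\sum_{i\in B_{k-1}}b_i\le 1$ for all $k\in[1,2n]$. Only feasible packings are considered. The length $L(p)$ of a packing $p$ is the number of bins containing at least one bar. Algorithm GALO. Sort all 2-BCs into a list in lexicographically non-increasing order of $(a_i,b_i)$ (non-increasing $a_i$, ties broken by non-increasing $b_i$, remaining ties arbitrarily). Process bins $k=1,2,\ldots$ in turn until all 2-BCs are packed: at bin $k$, take the first 2-BC $y$ in the current list (if any) whose first bar can be placed in bin $k$, that is, if a 2-BC $x$ was assigned $p(x)=k-1$,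 then $b_x+a_y\le 1$ is required, and if no 2-BC was assigned to $k-1$, then $y$ is simply the first 2-BC of the list; set $p(y)=k$ and remove $y$ from the list; if no such $y$ exists, assign no 2-BC to $k$. Then move to the next bin. The resulting packing is $p^g$. *)

theory Defs
  imports Complex_Main
begin

text \<open>
  Two-bar charts are indexed by elements of an arbitrary type \<open>'i\<close>; chart \<open>i\<close> has the bars
  \<open>a i\<close> and \<open>b i\<close>. Distinct charts may thus have equal heights.
\<close>

definition two_bar_chart :: "('i \<Rightarrow> real) \<Rightarrow> ('i \<Rightarrow> real) \<Rightarrow> 'i \<Rightarrow> bool" where
  "two_bar_chart a b i \<longleftrightarrow> a i \<in> {0<..1} \<and> b i \<in> {0<..1}"

definition big :: "real \<Rightarrow> bool" where
  "big h \<longleftrightarrow> h > 1 / 2"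

definition packing :: "'i set \<Rightarrow> ('i \<Rightarrow> nat) \<Rightarrow> bool" where
  "packing S p \<longleftrightarrow> p ` S \<subseteq> {1..2 * card S - 1}"

text \<open>For a packing, \<open>assigned S p 0\<close> is empty, as \<open>p\<close> is positive on \<open>S\<close>.\<close>

definition assigned :: "'i set \<Rightarrow> ('i \<Rightarrow> nat) \<Rightarrow> nat \<Rightarrow> 'i set" where
  "assigned S p k = {i \<in> S. p i = k}"

definition feasible :: "'i set \<Rightarrow> ('i \<Rightarrow> real) \<Rightarrow> ('i \<Rightarrow> real) \<Rightarrow> ('i \<Rightarrow> nat) \<Rightarrow> bool" where
  "feasible S a b p \<longleftrightarrow> packing S p \<and>
     (\<forall>k\<in>{1..2 * card S}. (\<Sum>i\<in>assigned S p k. a i) + (\<Sum>i\<in>assigned S p (k - 1). b i) \<le> 1)"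

definition packing_length :: "'i set \<Rightarrow> ('i \<Rightarrow> nat) \<Rightarrow> nat" where
  "packing_length S p = card {k. \<exists>i\<in>S. k = p i \<or> k = p i + 1}"

definition OPT :: "'i set \<Rightarrow> ('i \<Rightarrow> real) \<Rightarrow> ('i \<Rightarrow> real) \<Rightarrow> nat" where
  "OPT S a b = (LEAST l. \<exists>p. feasible S a b p \<and> packing_length S p = l)"

text \<open>The minimum is over a nonempty set: putting the charts into bins 1, 3, 5 and so on is feasible.\<close>

lemma feasible_exists:
  assumes "finite S" and "\<forall>i\<in>S. two_bar_chart a b i"
  shows "\<exists>p. feasible S a b p"
proof -
  obtain f where f: "bij_betw f S {0..<card S}"
    using ex_bij_betw_finite_nat[OF assms(1)] by blast
  define p where "p i = 2 * f i + 1" for i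
  have lt: "f i < card S" if "i \<in> S" for i
    using bij_betwE[OF f] that by auto
  have inj: "i = j" if "i \<in> S" "j \<in> S" "f i = f j" for i j
    using bij_betw_imp_inj_on[OF f] that by (auto dest: inj_onD)
  have "packing S p"
  proof -
    have "p i \<in> {1..2 * card S - 1}" if "i \<in> S" for i
      using lt[OF that] unfolding p_def by auto
    then show ?thesis unfolding packing_def by blast
  qed
  moreover have "(\<Sum>i\<in>assigned S p k. a i) + (\<Sum>i\<in>assigned S p (k - 1). b i) \<le> 1"
    if "k \<ge> 1" for k
  proof -
    have bound: "(\<Sum>i\<in>assigned S p m. h i) \<le> 1"
      if h: "\<forall>i\<in>S. h i \<le> 1" for h :: "'a \<Rightarrow> real" and m
    proof (cases "assigned S p m = {}")
      case False
      then obtain i where i: "i \<in> S" "p i = m" unfolding assigned_def by blast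
      then have "assigned S p m = {i}"
        unfolding assigned_def p_def using inj by auto
      then show ?thesis using h i by simp
    qed simp
    have empty: "assigned S p m = {}" if "even m" for m
      using that unfolding assigned_def p_def by auto
    have a1: "\<forall>i\<in>S. a i \<le> 1" and b1: "\<forall>i\<in>S. b i \<le> 1"
      using assms(2) unfolding two_bar_chart_def by auto
    show ?thesis
    proof (cases "even k")
      case True
      then show ?thesis using bound[OF b1] empty by simp
    next
      case False
      then have "even (k - 1)" by simp
      then show ?thesis using bound[OF a1] empty by simp
    qed
  qed
  ultimately show ?thesis unfolding feasible_def by auto
qed

text \<open>
  The admissible initial lists of GALO. Charts with equal bars may come in any order, so
  there may be several such lists for the same \<open>S\<close>.
\<close>

definition galo_list :: "'i set \<Rightarrow> ('i \<Rightarrow> real) \<Rightarrow> ('i \<Rightarrow> real) \<Rightarrow> 'i list \<Rightarrow> bool" where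
  "galo_list S a b xs \<longleftrightarrow> set xs = S \<and> distinct xs \<and>
     sorted_wrt (\<lambda>x y. a x > a y \<or> (a x = a y \<and> b x \<ge> b y)) xs"

text \<open>
  \<open>prev\<close> is the chart assigned to bin \<open>k - 1\<close>, if any, and \<open>fits a b prev y\<close> says that the first
  bar of \<open>y\<close> can be placed in bin \<open>k\<close>.
\<close>

definition fits :: "('i \<Rightarrow> real) \<Rightarrow> ('i \<Rightarrow> real) \<Rightarrow> 'i option \<Rightarrow> 'i \<Rightarrow> bool" where
  "fits a b prev y \<longleftrightarrow> (case prev of None \<Rightarrow> True | Some x \<Rightarrow> b x + a y \<le> 1)"

text \<open>
  \<open>galo_from a b k prev xs\<close> processes bins \<open>k, k + 1, \<dots>\<close> with current list \<open>xs\<close>. The value \<open>0\<close>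
  is a dummy for charts that are not in the list.
\<close>

function galo_from ::
  "('i \<Rightarrow> real) \<Rightarrow> ('i \<Rightarrow> real) \<Rightarrow> nat \<Rightarrow> 'i option \<Rightarrow> 'i list \<Rightarrow> 'i \<Rightarrow> nat" where
  "galo_from a b k prev xs =
     (if xs = [] then (\<lambda>_. 0)
      else case find (fits a b prev) xs of
             Some y \<Rightarrow> (galo_from a b (k + 1) (Some y) (remove1 y xs))(y := k)
           | None \<Rightarrow> galo_from a b (k + 1) None xs)"
  by pat_completeness auto
termination
proof (relation "measures [\<lambda>(a, b, k, prev, xs). length xs,
                           \<lambda>(a, b, k, prev, xs). case prev of None \<Rightarrow> 0 | Some _ \<Rightarrow> 1]")
  fix a b :: "'i \<Rightarrow> real" and k :: nat and prev and xs :: "'i list" and y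
  assume "xs \<noteq> []" and "find (fits a b prev) xs = Some y"
  then have "y \<in> set xs" by (auto simp: find_Some_iff)
  then show "((a, b, k + 1, Some y, remove1 y xs), (a, b, k, prev, xs)) \<in>
      measures [\<lambda>(a, b, k, prev, xs). length xs,
                \<lambda>(a, b, k, prev, xs). case prev of None \<Rightarrow> 0 | Some _ \<Rightarrow> 1]"
    using \<open>xs \<noteq> []\<close> by (simp add: length_remove1)
next
  fix a b :: "'i \<Rightarrow> real" and k :: nat and prev and xs :: "'i list"
  assume "xs \<noteq> []" and "find (fits a b prev) xs = None"
  then have "prev \<noteq> None" by (cases xs; cases prev) (auto simp: fits_def)
  then show "((a, b, k + 1, None, xs), (a, b, k, prev, xs)) \<in>
      measures [\<lambda>(a, b, k, prev, xs). length xs,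
                \<lambda>(a, b, k, prev, xs). case prev of None \<Rightarrow> 0 | Some _ \<Rightarrow> 1]"
    by auto
qed simp

declare galo_from.simps [simp del]

definition galo :: "('i \<Rightarrow> real) \<Rightarrow> ('i \<Rightarrow> real) \<Rightarrow> 'i list \<Rightarrow> 'i \<Rightarrow> nat" where
  "galo a b xs = galo_from a b 1 None xs"

end

(*
  Since all first bars are big, a feasible packing p is injective, hence its length is n plus the
  number of heads, i.e. of charts that no chart precedes in the bin before. Fix a threshold t. If
  x immediately precedes y in a feasible packing and a y \<ge> t, then b x \<le> 1 - t; so every feasible
  packing has at least |Y| - |X| heads, where Y = {y. a y \<ge> t} and X = {x. b x \<le> 1 - t}.

  For GALO take t to be the least first bar in its last run T of consecutive charts, attained at z.
  The chart z is available as long as T has not been started. So all heads lie in Y, and every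
  chart of X placed before T is followed by a chart of Y, also placed before T. As T is contained
  in Y, it follows that |Y| \<ge> (m - 1) + |X - T| + |T| \<ge> m - 1 + |X|, where m is the number of
  heads of GALO. Hence every feasible packing has at least m - 1 heads.
*)

theory Submission
  imports Defs
begin

section \<open>Heads of feasible packings\<close>

definition heads :: "'i set \<Rightarrow> ('i \<Rightarrow> nat) \<Rightarrow> 'i set" where
  "heads S p = {y \<in> S. \<forall>x\<in>S. p y \<noteq> p x + 1}"

text \<open>The nonempty bins are of two disjoint kinds: those with a second bar, namely the bins
  \<open>p i + 1\<close>, and those with a first bar only, which are the bins of the heads.
  Injectivity counts both kinds.\<close>

lemma packing_length_eq_heads:
  assumes "finite S" and "inj_on p S"
  shows "packing_length S p = card S + card (heads S p)"
proof -
  have "{k. \<exists>i\<in>S. k = p i \<or> k = p i + 1} = (\<lambda>i. p i + 1) ` S \<union> p ` heads S p"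
    unfolding heads_def by auto
  moreover have "(\<lambda>i. p i + 1) ` S \<inter> p ` heads S p = {}"
    unfolding heads_def by auto
  moreover have "card ((\<lambda>i. p i + 1) ` S) = card S"
    using assms(2) by (intro card_image) (auto simp: inj_on_def)
  moreover have "card (p ` heads S p) = card (heads S p)"
    using assms(2) by (intro card_image) (auto simp: inj_on_def heads_def)
  moreover have "finite (heads S p)"
    using assms(1) unfolding heads_def by simp
  ultimately show ?thesis
    unfolding packing_length_def using assms(1) by (simp add: card_Un_disjoint)
qed

lemma feasible_bin:
  assumes "feasible S a b p" and "i \<in> S"
  shows "(\<Sum>j\<in>assigned S p (p i). a j) + (\<Sum>j\<in>assigned S p (p i - 1). b j) \<le> 1"
proof -
  have "p i \<in> {1..2 * card S - 1}"
    using assms unfolding feasible_def packing_def by blast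
  then have "p i \<in> {1..2 * card S}" by auto
  then show ?thesis using assms(1) unfolding feasible_def by blast
qed

lemma feasible_inj_on:
  assumes "finite S" and "\<forall>i\<in>S. two_bar_chart a b i" and "\<forall>i\<in>S. big (a i)"
    and "feasible S a b p"
  shows "inj_on p S"
proof (rule inj_onI, rule ccontr)
  fix x y assume xy: "x \<in> S" "y \<in> S" "p x = p y" "x \<noteq> y"
  have pos: "0 \<le> a i" "0 \<le> b i" if "i \<in> S" for i
    using assms(2) that by (auto simp: two_bar_chart_def less_imp_le)
  have "a x + a y = (\<Sum>i\<in>{x, y}. a i)" using xy by simp
  also have "\<dots> \<le> (\<Sum>i\<in>assigned S p (p x). a i)"
    using xy assms(1) pos by (intro sum_mono2) (auto simp: assigned_def)
  finally have "a x + a y \<le> (\<Sum>i\<in>assigned S p (p x). a i)" .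
  moreover have "0 \<le> (\<Sum>i\<in>assigned S p (p x - 1). b i)"
    using pos by (intro sum_nonneg) (auto simp: assigned_def)
  moreover have "1 < a x + a y"
    using bspec[OF assms(3) xy(1)] bspec[OF assms(3) xy(2)] by (simp add: big_def)
  ultimately show False using feasible_bin[OF assms(4) xy(1)] by linarith
qed

lemma feasible_consecutive:
  assumes "finite S" and "\<forall>i\<in>S. two_bar_chart a b i" and "feasible S a b p"
    and "x \<in> S" and "y \<in> S" and "p y = p x + 1"
  shows "b x + a y \<le> 1"
proof -
  have pos: "0 \<le> a i" "0 \<le> b i" if "i \<in> S" for i
    using assms(2) that by (auto simp: two_bar_chart_def less_imp_le)
  have "a y \<le> (\<Sum>i\<in>assigned S p (p y). a i)"
    using assms(1,5) pos by (intro member_le_sum) (auto simp: assigned_def)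
  moreover have "b x \<le> (\<Sum>i\<in>assigned S p (p y - 1). b i)"
    using assms(1,4,6) pos by (intro member_le_sum) (auto simp: assigned_def)
  ultimately show ?thesis using feasible_bin[OF assms(3,5)] by linarith
qed

text \<open>A chart with first bar at least \<open>t\<close> that is not a head follows some
  \<open>x\<close> with \<open>b x + t \<le> 1\<close>, and by injectivity each such
  \<open>x\<close> has at most one successor.\<close>

lemma card_le_heads_add:
  assumes "finite S" and "\<forall>i\<in>S. two_bar_chart a b i" and "\<forall>i\<in>S. big (a i)"
    and "feasible S a b p"
  shows "card {y\<in>S. t \<le> a y} \<le> card (heads S p) + card {x\<in>S. b x + t \<le> 1}"
proof -
  define Y X where "Y = {y\<in>S. t \<le> a y}" and "X = {x\<in>S. b x + t \<le> 1}"
  have inj: "inj_on p S" using feasible_inj_on[OF assms] .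
  have fin: "finite Y" "finite X" "finite (heads S p)"
    using assms(1) by (auto simp: Y_def X_def heads_def)
  \<comment> \<open>Comparing bins instead of charts avoids choosing a predecessor for each
    chart.\<close>
  have "p ` (Y - heads S p) \<subseteq> (\<lambda>x. p x + 1) ` X"
  proof
    fix k assume "k \<in> p ` (Y - heads S p)"
    then obtain y x where yx: "y \<in> Y" "k = p y" "y \<in> S" "x \<in> S" "p y = p x + 1"
      by (auto simp: heads_def Y_def)
    then have "b x + a y \<le> 1"
      using feasible_consecutive[OF assms(1,2,4)] by blast
    then have "x \<in> X" using yx by (auto simp: X_def Y_def)
    then show "k \<in> (\<lambda>x. p x + 1) ` X" using yx by auto
  qed
  then have "card (p ` (Y - heads S p)) \<le> card X"
    using surj_card_le[OF fin(2)] by blast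
  moreover have "card (p ` (Y - heads S p)) = card (Y - heads S p)"
    by (rule card_image) (rule inj_on_subset[OF inj], auto simp: Y_def)
  moreover have "card Y - card (heads S p) \<le> card (Y - heads S p)"
    by (rule diff_card_le_card_Diff[OF fin(3)])
  ultimately show ?thesis unfolding X_def Y_def by linarith
qed

section \<open>Greedy properties of GALO\<close>

lemma find_sorted_max:
  fixes a :: "'i \<Rightarrow> 'b::preorder"
  assumes "sorted_wrt (\<lambda>x y. a y \<le> a x) xs" and "find P xs = Some y"
    and "z \<in> set xs" and "P z"
  shows "a z \<le> a y"
  using assms by (induction xs) (auto split: if_splits)

text \<open>
  The disjunction in the last clause excludes that \<open>y\<close> comes right after \<open>prev\<close>, which is not in
  \<open>xs\<close> and hence invisible to \<open>heads\<close>.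
\<close>

lemma galo_from_greedy:
  fixes a b :: "'i \<Rightarrow> real" and k :: nat and prev :: "'i option"
  assumes "distinct xs" and "sorted_wrt (\<lambda>x y. a y \<le> a x) xs"
  defines "p \<equiv> galo_from a b k prev xs"
  shows "inj_on p (set xs)"
    and "\<And>x. x \<in> set xs \<Longrightarrow> k \<le> p x"
    and "\<And>w z. \<lbrakk>prev = Some w; z \<in> set xs; b w + a z \<le> 1\<rbrakk>
           \<Longrightarrow> \<exists>y\<in>set xs. p y = k \<and> a z \<le> a y"
    and "\<And>x z. \<lbrakk>x \<in> set xs; z \<in> set xs; p x < p z; b x + a z \<le> 1\<rbrakk>
           \<Longrightarrow> \<exists>y\<in>set xs. p y = p x + 1 \<and> a z \<le> a y"
    and "\<And>y z. \<lbrakk>y \<in> heads (set xs) p; z \<in> set xs; p y \<le> p z; p y \<noteq> k \<or> prev = None\<rbrakk>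
           \<Longrightarrow> a z \<le> a y"
proof -
  \<comment> \<open>The clauses go through the induction together: the third one, about the
    successor of \<open>prev\<close>, supplies the case of the fourth in which \<open>x\<close> is
    the chart just placed.\<close>
  have "inj_on p (set xs)
    \<and> (\<forall>x\<in>set xs. k \<le> p x)
    \<and> (\<forall>w. \<forall>z\<in>set xs. prev = Some w \<longrightarrow> b w + a z \<le> 1 \<longrightarrow> (\<exists>y\<in>set xs. p y = k \<and> a z \<le> a y))
    \<and> (\<forall>x\<in>set xs. \<forall>z\<in>set xs. p x < p z \<longrightarrow> b x + a z \<le> 1
         \<longrightarrow> (\<exists>y\<in>set xs. p y = p x + 1 \<and> a z \<le> a y))
    \<and> (\<forall>y\<in>heads (set xs) p. \<forall>z\<in>set xs. p y \<le> p z \<longrightarrow> p y \<noteq> k \<or> prev = None \<longrightarrow> a z \<le> a y)"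
    using assms(1,2) unfolding p_def
  proof (induction a b k prev xs rule: galo_from.induct)
    case (1 a b k prev xs)
    let ?P = "\<lambda>k prev xs. galo_from a b k prev xs"
    show ?case
    proof (cases "xs = []")
      case True
      then show ?thesis by (simp add: heads_def)
    next
      case ne: False
      show ?thesis
      proof (cases "find (fits a b prev) xs")
        case None
        define q where "q = ?P (k + 1) None xs"
        have eq: "?P k prev xs = q"
          using ne None by (subst galo_from.simps) (simp add: q_def)
        \<comment> \<open>Bin \<open>k\<close> stays empty, so the remaining bins are filled with
          \<open>prev = None\<close>, where the head clause holds without exception.\<close>
        note IH = "1.IH"(1)[OF ne None "1.prems", folded q_def]
        have nofit: "\<not> fits a b prev y" if "y \<in> set xs" for y
          using None that by (auto simp: find_None_iff)
        from IH have ge: "\<forall>x\<in>set xs. k + 1 \<le> q x" by blast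
        show ?thesis unfolding eq
        proof (intro conjI)
          show "\<forall>x\<in>set xs. k \<le> q x" using ge by auto
          show "\<forall>w. \<forall>z\<in>set xs. prev = Some w \<longrightarrow> b w + a z \<le> 1
                  \<longrightarrow> (\<exists>y\<in>set xs. q y = k \<and> a z \<le> a y)"
            using nofit by (auto simp: fits_def)
        qed (use IH in blast)+
      next
        case (Some y)
        define ys q where "ys = remove1 y xs" and "q = ?P (k + 1) (Some y) (remove1 y xs)"
        define r where "r = q(y := k)"
        have eq: "?P k prev xs = r"
          using ne Some by (subst galo_from.simps) (simp add: q_def r_def)
        have y: "y \<in> set xs" using Some by (auto simp: find_Some_iff)
        have ys: "set ys = set xs - {y}" "distinct ys"
          using "1.prems" by (simp_all add: ys_def)
        have "sorted_wrt (\<lambda>x y. a y \<le> a x) ys"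
          using "1.prems"(2) unfolding ys_def by (induction xs) auto
        note IH = "1.IH"(2)[OF ne Some, folded ys_def q_def, OF ys(2) this]
        have first: "a z \<le> a y" if "z \<in> set xs" "fits a b prev z" for z
          using find_sorted_max[OF "1.prems"(2) Some that] .
        from IH have ge: "\<forall>x\<in>set ys. k + 1 \<le> q x" by blast
        have r: "r y = k" "\<And>x. x \<noteq> y \<Longrightarrow> r x = q x" by (auto simp: r_def)
        have rgt: "k + 1 \<le> r x" if "x \<in> set xs" "x \<noteq> y" for x
          using that ge ys r by auto
        show ?thesis unfolding eq
        proof (intro conjI ballI allI impI)
          have "inj_on q (set ys)" using IH by blast
          then show "inj_on r (set xs)"
            using rgt ys r unfolding inj_on_def by (metis Diff_iff Suc_eq_plus1 Suc_n_not_le_n singletonD)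
        next
          fix x assume "x \<in> set xs"
          then show "k \<le> r x" using rgt[of x] r by (cases "x = y") auto
        next
          fix w z assume "z \<in> set xs" "prev = Some w" "b w + a z \<le> 1"
          then have "a z \<le> a y" by (intro first) (auto simp: fits_def)
          then show "\<exists>v\<in>set xs. r v = k \<and> a z \<le> a v" using y r by blast
        next
          fix x z assume xz: "x \<in> set xs" "z \<in> set xs" "r x < r z" "b x + a z \<le> 1"
          \<comment> \<open>\<open>y\<close> occupies the lowest bin, so it cannot come after
            \<open>x\<close>.\<close>
          have zy: "z \<noteq> y" using xz r rgt[of x] by (cases "x = y") auto
          then have zys: "z \<in> set ys" using xz ys by auto
          have "\<exists>v\<in>set ys. q v = r x + 1 \<and> a z \<le> a v"
          proof (cases "x = y")
            case True
            then show ?thesis using IH zys xz r(1) by simp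
          next
            case False
            then have "x \<in> set ys" "q x < q z" "r x = q x" using xz ys r zy by auto
            then show ?thesis using IH zys xz by auto
          qed
          then show "\<exists>v\<in>set xs. r v = r x + 1 \<and> a z \<le> a v"
            using ys r by auto
        next
          fix v z assume vz: "v \<in> heads (set xs) r" "z \<in> set xs" "r v \<le> r z"
            "r v \<noteq> k \<or> prev = None"
          have v: "v \<in> set xs" "\<forall>x\<in>set xs. r v \<noteq> r x + 1"
            using vz(1) by (auto simp: heads_def)
          show "a z \<le> a v"
          proof (cases "v = y")
            case True
            then have "prev = None" using vz r by auto
            then show ?thesis using first[OF vz(2)] True by (simp add: fits_def)
          next
            case False
            have zy: "z \<noteq> y" using rgt[OF v(1) False] vz(3) r by auto
            \<comment> \<open>A chart in bin \<open>k + 1\<close> would follow \<open>y\<close>; so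
              the head \<open>v\<close> avoids the bin that the induction hypothesis for
              \<open>Some y\<close> exempts.\<close>
            have "r v \<noteq> k + 1" using v(2) y r by auto
            moreover have "v \<in> heads (set ys) q"
              using v False ys r by (auto simp: heads_def)
            ultimately show ?thesis
              using IH vz zy ys r False by (metis Diff_iff singletonD)
          qed
        qed
      qed
    qed
  qed
  then show "inj_on p (set xs)"
    and "\<And>x. x \<in> set xs \<Longrightarrow> k \<le> p x"
    and "\<And>w z. \<lbrakk>prev = Some w; z \<in> set xs; b w + a z \<le> 1\<rbrakk>
           \<Longrightarrow> \<exists>y\<in>set xs. p y = k \<and> a z \<le> a y"
    and "\<And>x z. \<lbrakk>x \<in> set xs; z \<in> set xs; p x < p z; b x + a z \<le> 1\<rbrakk>
           \<Longrightarrow> \<exists>y\<in>set xs. p y = p x + 1 \<and> a z \<le> a y"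
    and "\<And>y z. \<lbrakk>y \<in> heads (set xs) p; z \<in> set xs; p y \<le> p z; p y \<noteq> k \<or> prev = None\<rbrakk>
           \<Longrightarrow> a z \<le> a y"
    by - (elim conjE, simp)+
qed

section \<open>Counting the heads of a greedy packing\<close>

text \<open>Counterpart of \<open>card_le_heads_add\<close>: at a suitable threshold the lower bound
  on the number of heads is attained up to one. The extra 1 pays for the head of the last run, which
  is already counted in that run.\<close>

lemma greedy_heads_add_le:
  fixes a b :: "'i \<Rightarrow> real" and p :: "'i \<Rightarrow> nat"
  assumes "finite S" and "S \<noteq> {}" and inj: "inj_on p S"
    and succ: "\<And>x z. \<lbrakk>x \<in> S; z \<in> S; p x < p z; b x + a z \<le> 1\<rbrakk>
                 \<Longrightarrow> \<exists>y\<in>S. p y = p x + 1 \<and> a z \<le> a y"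
    and head: "\<And>y z. \<lbrakk>y \<in> heads S p; z \<in> S; p y \<le> p z\<rbrakk> \<Longrightarrow> a z \<le> a y"
  obtains t where "card (heads S p) + card {x\<in>S. b x + t \<le> 1} \<le> card {y\<in>S. t \<le> a y} + 1"
proof -
  have finH: "finite (heads S p)" using assms(1) by (simp add: heads_def)
  have "arg_min_on p S \<in> heads S p"
    using arg_min_if_finite[OF assms(1,2), of p] by (auto simp: heads_def)
  then have neH: "heads S p \<noteq> {}" by blast
  then have "Max (p ` heads S p) \<in> p ` heads S p"
    using finH by (intro Max_in) auto
  then obtain h where h: "h \<in> heads S p" "p h = Max (p ` heads S p)" by auto
  have hmax: "p y \<le> p h" if "y \<in> heads S p" for y
    using that h(2) finH by simp
  have hS: "h \<in> S" "\<And>x. x \<in> S \<Longrightarrow> p h \<noteq> p x + 1" using h(1) by (auto simp: heads_def)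
  \<comment> \<open>As \<open>h\<close> is the last head, \<open>T\<close> is the last run. The
    threshold will be \<open>a z\<close>.\<close>
  define T where "T = {y\<in>S. p h \<le> p y}"
  have finT: "finite T" "h \<in> T" using assms(1) hS by (auto simp: T_def)
  define z where "z = arg_min_on a T"
  have z: "z \<in> T" "\<And>y. y \<in> T \<Longrightarrow> a z \<le> a y"
    using arg_min_if_finite(1)[of T a] arg_min_least[of T _ a] finT by (auto simp: z_def)
  have zS: "z \<in> S" "p h \<le> p z" using z(1) by (auto simp: T_def)
  define X Y where "X = {x\<in>S. b x + a z \<le> 1}" and "Y = {y\<in>S. a z \<le> a y}"
  \<comment> \<open>The earlier heads \<open>H\<close>, the earlier non-heads \<open>N\<close>
    reaching the threshold, and \<open>T\<close> will be disjoint parts of \<open>Y\<close>.\<close>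
  define H where "H = heads S p - {h}"
  define N where "N = {y\<in>Y - T. y \<notin> heads S p}"
  have fin: "finite X" "finite Y" "finite H" "finite N"
    using assms(1) finH by (auto simp: X_def Y_def H_def N_def)
  have "(\<lambda>x. p x + 1) ` (X - T) \<subseteq> p ` N"
  proof
    fix k assume "k \<in> (\<lambda>x. p x + 1) ` (X - T)"
    then obtain x where x: "x \<in> S" "b x + a z \<le> 1" "p x < p h" "k = p x + 1"
      unfolding X_def T_def by fastforce
    \<comment> \<open>\<open>z\<close> is still unplaced after \<open>x\<close> and would fit there,
      so GALO places a chart at least as high.\<close>
    then obtain y where y: "y \<in> S" "p y = p x + 1" "a z \<le> a y"
      using succ[of x z] zS by auto
    \<comment> \<open>\<open>y\<close> lies in bin \<open>p h\<close> at the latest, and not in it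
      because the head \<open>h\<close> follows no chart.\<close>
    have "p y < p h" using y(2) x(1,3) hS(2)[of x] by linarith
    then have "y \<in> N" using y x(1) by (auto simp: N_def Y_def T_def heads_def)
    then show "k \<in> p ` N" unfolding x(4) y(2)[symmetric] by (rule imageI)
  qed
  then have "card ((\<lambda>x. p x + 1) ` (X - T)) \<le> card N"
    using surj_card_le[OF fin(4)] by blast
  moreover have "card ((\<lambda>x. p x + 1) ` (X - T)) = card (X - T)"
    using inj by (intro card_image) (auto simp: inj_on_def X_def)
  ultimately have XN: "card (X - T) \<le> card N" by simp
  have HT: "p y < p h" if "y \<in> H" for y
    using that hmax[of y] hS(1) inj by (auto simp: H_def heads_def inj_on_def order_le_less)
  \<comment> \<open>\<open>z\<close> is also available when an earlier head is chosen.\<close>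
  have "a z \<le> a y" if "y \<in> H" for y
    using that HT[OF that] head[of y z] zS by (auto simp: H_def)
  then have "H \<union> N \<union> T \<subseteq> Y"
    using z(2) by (auto simp: H_def N_def Y_def T_def heads_def)
  then have "card (H \<union> N \<union> T) \<le> card Y" by (rule card_mono[OF fin(2)])
  moreover have "card (H \<union> N \<union> T) = card H + card N + card T"
  proof -
    have "H \<inter> N = {}" by (auto simp: H_def N_def)
    moreover have "(H \<union> N) \<inter> T = {}" using HT by (force simp: N_def T_def)
    ultimately show ?thesis using fin finT by (simp add: card_Un_disjoint)
  qed
  moreover have "card X \<le> card (X - T) + card T"
    using diff_card_le_card_Diff[OF finT(1), of X] by linarith
  moreover have "card (heads S p) = card H + 1"
    using h(1) finH unfolding H_def by (metis Suc_eq_plus1 card_Suc_Diff1)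
  ultimately have "card (heads S p) + card X \<le> card Y + 1"
    using XN by linarith
  then show thesis using that[of "a z"] by (simp add: X_def Y_def)
qed

section \<open>Comparison with an optimal packing\<close>

theorem corollary1:
  fixes S :: "'i set" and a b :: "'i \<Rightarrow> real" and xs :: "'i list"
  assumes "finite S" and "card S \<ge> 1"
    and "\<forall>i\<in>S. two_bar_chart a b i"
    and "\<forall>i\<in>S. big (a i)"
    and "galo_list S a b xs"
  shows "packing_length S (galo a b xs) \<le> OPT S a b + 1"
proof -
  define p where "p = galo a b xs"
  have S: "set xs = S" and dist: "distinct xs"
    using assms(5) by (auto simp: galo_list_def)
  have sorted: "sorted_wrt (\<lambda>x y. a y \<le> a x) xs"
    by (rule sorted_wrt_mono_rel[OF _ conjunct2[OF conjunct2[OF assms(5)[unfolded galo_list_def]]]])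
      auto
  \<comment> \<open>With \<open>prev = None\<close> the head clause covers every head, including the
    one in bin 1.\<close>
  note greedy = galo_from_greedy[OF dist sorted, where b = b and k = 1 and prev = None,
      folded galo_def, folded p_def, unfolded S]
  have "S \<noteq> {}" using assms(2) by auto
  then obtain t where
    t: "card (heads S p) + card {x\<in>S. b x + t \<le> 1} \<le> card {y\<in>S. t \<le> a y} + 1"
    using greedy_heads_add_le[OF assms(1) _ greedy(1), of b a] greedy(4,5) by blast
  have "\<exists>l q. feasible S a b q \<and> packing_length S q = l"
    using feasible_exists[OF assms(1,3)] by blast
  from LeastI_ex[OF this] obtain q where q: "feasible S a b q" "packing_length S q = OPT S a b"
    unfolding OPT_def by blast
  \<comment> \<open>Both bounds use the same \<open>t\<close>, so the two threshold counts
    cancel.\<close>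
  have "card (heads S p) \<le> card (heads S q) + 1"
    using t card_le_heads_add[OF assms(1,3,4) q(1), of t] by linarith
  then show ?thesis
    using packing_length_eq_heads[OF assms(1) greedy(1)] q(2)
      packing_length_eq_heads[OF assms(1) feasible_inj_on[OF assms(1,3,4) q(1)]]
    unfolding p_def by linarith
qed

end
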